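(* Let $f\colon S^2\to S^2$ be an expanding Thurston map, let $d$ be a visual metric on $S^2$ for $f$ with expansion factor $\Lambda>1$, and let $\mathcal C\subseteq S^2$ be a Jordan curve containing $\operatorname{post} f$. There is a constant $\beta_0>1$ depending only on $f$, $\mathcal C$, and $d$ such that for every real number $\eta>0$ there exists a constant $\delta_3\in(0,1)$ for which the following holds: for each $\delta\in(0,\delta_3]$, if $x\in S^2$ and $l\in\mathbb N$ satisfy $d(x,f^l(x))\le\delta$ and $d(f^i(x),\operatorname{crit} f)\ge\eta$ for all $i\in\{0,1,\dots,l\}$, then there exists $y\in S^2$ such that $f^l(y)=y$ and $d(f^i(x),f^i(y))\le\beta_0\,\delta\,\Lambda^{-(l-i)}\le\eta/2$ for each $i\in\{0,1,\dots,l\}$.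
   Context: $\mathbb N=\{1,2,\dots\}$, $\mathbb N_0=\mathbb N\cup\{0\}$. $S^2$ is an oriented topological $2$-sphere. A continuous map $f\colon S^2\to S^2$ is a branched covering map if near each $x\in S^2$, in suitable orientation-preserving local homeomorphic coordinates sending $x$ and $f(x)$ to $0\in\mathbb C$, it has the form $z\mapsto z^k$ with $k=\deg_f(x)\in\mathbb N$. Put $\operatorname{crit} f=\{x:\deg_f(x)\ge 2\}$ and $\operatorname{post} f=\{f^n(x): x\in\operatorname{crit} f,\ n\in\mathbb N\}$. A Thurston map is a branched covering map of topological degree $\ge 2$ with $\operatorname{post} f$ finite. For a Jordan curve $\mathcal C\subseteq S^2$ with $\operatorname{post} f\subseteq\mathcal C$ and $n\in\mathbb N_0$: the $n$-tiles are the closures of the connected components of $S^2\setminus f^{-n}(\mathcal C)$; the $n$-edges are the closures of the connected components of $f^{-n}(\mathcal C)\setminus f^{-n}(\operatorname{post} f)$; the $n$-vertices are the points of $f^{-n}(\operatorname{post} f)$; the $n$-cells are the $n$-tiles, the $n$-edges, and the singletons $\{v\}$ with $v$ an $n$-vertex. A Thurston map $f$ is expanding if for some (equivalently, every) metric inducing the topology of $S^2$ and some (equivalently, every) Jordan curve $\mathcal C\supseteq\operatorname{post} f$, the maximal diameter of $n$-tiles tends to $0$ as $n\to+\infty$. A metric $d$ on $S^2$ is a visual metric for an expanding Thurston map $f$ with expansion factor $\Lambda>1$ if for some (equivalently, every) Jordan curve $\mathcal C\supseteq\operatorname{post} f$ there is $C\ge1$ such that for all $n\in\mathbb N_0$: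 $d(\sigma,\tau)\ge C^{-1}\Lambda^{-n}$ for all disjoint $n$-cells $\sigma,\tau$, and $C^{-1}\Lambda^{-n}\le\operatorname{diam}_d(\tau)\le C\Lambda^{-n}$ for all $n$-edges and $n$-tiles $\tau$. For a set $A$, $d(x,A)=\inf_{a\in A}d(x,a)$. *)

theory Defs
  imports "HOL-Complex_Analysis.Complex_Analysis" "HOL-Homology.Homology"
begin

text \<open>
  The sphere is an arbitrary topological space, given as a type \<open>'a\<close> that is homeomorphic to the
  standard 2-sphere. Its orientation is given by an oriented atlas, that is, a family of complex
  charts covering it whose coordinate changes all preserve the orientation.
\<close>

type_synonym 'a chart = "'a set \<times> ('a \<Rightarrow> complex)"

definition is_chart :: "'a::topological_space chart \<Rightarrow> bool" where
  "is_chart c \<longleftrightarrow>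
     open (fst c) \<and> open (snd c ` fst c) \<and> (\<exists>h. homeomorphism (fst c) (snd c ` fst c) (snd c) h)"

text \<open>Meant for a homeomorphism \<open>g\<close> between the open set \<open>W\<close> and another open set in the plane:
  the image of every positively oriented circle bounding a disc in \<open>W\<close> then winds once
  around the image of its
  centre, as opposed to minus once.\<close>

definition orientation_preserving_on :: "complex set \<Rightarrow> (complex \<Rightarrow> complex) \<Rightarrow> bool" where
  "orientation_preserving_on W g \<longleftrightarrow>
     (\<forall>z r. 0 < r \<and> cball z r \<subseteq> W \<longrightarrow> winding_number (g \<circ> circlepath z r) (g z) = 1)"

definition orientation_compatible ::
  "'a::topological_space chart \<Rightarrow> 'a chart \<Rightarrow> bool" where
  "orientation_compatible a b \<longleftrightarrow>
     orientation_preserving_on (snd a ` (fst a \<inter> fst b)) (snd b \<circ> inv_into (fst a) (snd a))"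

definition oriented_atlas :: "'a::topological_space chart set \<Rightarrow> bool" where
  "oriented_atlas A \<longleftrightarrow>
     (\<forall>a\<in>A. is_chart a) \<and> (\<Union>a\<in>A. fst a) = UNIV \<and> (\<forall>a\<in>A. \<forall>b\<in>A. orientation_compatible a b)"

definition oriented_sphere :: "'a::topological_space chart set \<Rightarrow> bool" where
  "oriented_sphere A \<longleftrightarrow>
     (UNIV :: 'a set) homeomorphic sphere (0 :: real ^ 3) 1 \<and> oriented_atlas A"

definition positive_chart :: "'a::topological_space chart set \<Rightarrow> 'a chart \<Rightarrow> bool" where
  "positive_chart A c \<longleftrightarrow> is_chart c \<and> (\<forall>a\<in>A. orientation_compatible a c)"

definition has_power_form ::
  "'a::topological_space chart set \<Rightarrow> ('a \<Rightarrow> 'a) \<Rightarrow> 'a \<Rightarrow> nat \<Rightarrow> bool" where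
  "has_power_form A f x k \<longleftrightarrow>
     (\<exists>U \<phi> V \<psi>. positive_chart A (U, \<phi>) \<and> positive_chart A (V, \<psi>) \<and>
        x \<in> U \<and> f x \<in> V \<and> f ` U \<subseteq> V \<and> \<phi> x = 0 \<and> \<psi> (f x) = 0 \<and>
        (\<forall>p\<in>U. \<psi> (f p) = \<phi> p ^ k))"

definition branched_covering :: "'a::topological_space chart set \<Rightarrow> ('a \<Rightarrow> 'a) \<Rightarrow> bool" where
  "branched_covering A f \<longleftrightarrow>
     continuous_on UNIV f \<and> (\<forall>x. \<exists>k\<ge>1. has_power_form A f x k)"

text \<open>The exponent is unique: it is the number of preimages near \<open>x\<close> of a point close to,
  but different from, \<open>f x\<close>.\<close>

definition local_degree :: "'a::topological_space chart set \<Rightarrow> ('a \<Rightarrow> 'a) \<Rightarrow> 'a \<Rightarrow> nat" where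
  "local_degree A f x = (THE k. k \<ge> 1 \<and> has_power_form A f x k)"

definition crit :: "'a::topological_space chart set \<Rightarrow> ('a \<Rightarrow> 'a) \<Rightarrow> 'a set" where
  "crit A f = {x. local_degree A f x \<ge> 2}"

definition post :: "'a::topological_space chart set \<Rightarrow> ('a \<Rightarrow> 'a) \<Rightarrow> 'a set" where
  "post A f = {(f ^^ n) x | n x. n \<ge> 1 \<and> x \<in> crit A f}"

text \<open>The library defines the Brouwer degree on \<^term>\<open>nsphere 2\<close>, its model of the 2-sphere inside
  \<^typ>\<open>nat \<Rightarrow> real\<close>. The degree of the conjugated map does not depend on the homeomorphism \<open>h\<close>, since
  the degree is multiplicative.\<close>

definition topological_degree :: "('a::topological_space \<Rightarrow> 'a) \<Rightarrow> int" where
  "topological_degree f =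
     (THE m. \<exists>h h'. homeomorphic_maps euclidean (nsphere 2) h h' \<and>
        m = Brouwer_degree2 2 (h \<circ> f \<circ> h'))"

definition Thurston_map :: "'a::topological_space chart set \<Rightarrow> ('a \<Rightarrow> 'a) \<Rightarrow> bool" where
  "Thurston_map A f \<longleftrightarrow>
     branched_covering A f \<and> topological_degree f \<ge> 2 \<and> finite (post A f)"

definition Jordan_curve :: "'a::topological_space set \<Rightarrow> bool" where
  "Jordan_curve C \<longleftrightarrow> C homeomorphic sphere (0 :: complex) 1"

definition tiles :: "('a::topological_space \<Rightarrow> 'a) \<Rightarrow> 'a set \<Rightarrow> nat \<Rightarrow> 'a set set" where
  "tiles f C n = closure ` components (UNIV - (f ^^ n) -` C)"

definition edges ::
  "'a::topological_space chart set \<Rightarrow> ('a \<Rightarrow> 'a) \<Rightarrow> 'a set \<Rightarrow> nat \<Rightarrow> 'a set set" where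
  "edges A f C n = closure ` components ((f ^^ n) -` C - (f ^^ n) -` post A f)"

definition vertices :: "'a::topological_space chart set \<Rightarrow> ('a \<Rightarrow> 'a) \<Rightarrow> nat \<Rightarrow> 'a set" where
  "vertices A f n = (f ^^ n) -` post A f"

definition cells ::
  "'a::topological_space chart set \<Rightarrow> ('a \<Rightarrow> 'a) \<Rightarrow> 'a set \<Rightarrow> nat \<Rightarrow> 'a set set" where
  "cells A f C n = tiles f C n \<union> edges A f C n \<union> (\<lambda>v. {v}) ` vertices A f n"

text \<open>Diameters and distances between sets with respect to an explicitly given metric \<open>d\<close>. They are
  extended reals, so that unbounded sets have diameter \<open>\<infinity>\<close> and the distance to the empty set
  is \<open>\<infinity>\<close>.\<close>

definition diam :: "('a \<Rightarrow> 'a \<Rightarrow> real) \<Rightarrow> 'a set \<Rightarrow> ereal" where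
  "diam d S = (SUP x\<in>S. SUP y\<in>S. ereal (d x y))"

definition set_dist :: "('a \<Rightarrow> 'a \<Rightarrow> real) \<Rightarrow> 'a set \<Rightarrow> 'a set \<Rightarrow> ereal" where
  "set_dist d S T = (INF x\<in>S. INF y\<in>T. ereal (d x y))"

definition point_dist :: "('a \<Rightarrow> 'a \<Rightarrow> real) \<Rightarrow> 'a \<Rightarrow> 'a set \<Rightarrow> ereal" where
  "point_dist d x S = (INF y\<in>S. ereal (d x y))"

definition expanding :: "'a::topological_space chart set \<Rightarrow> ('a \<Rightarrow> 'a) \<Rightarrow> bool" where
  "expanding A f \<longleftrightarrow>
     (\<exists>\<rho> C. Metric_space UNIV \<rho> \<and> Metric_space.mtopology UNIV \<rho> = euclidean \<and>
        Jordan_curve C \<and> post A f \<subseteq> C \<and>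
        (\<lambda>n. SUP X\<in>tiles f C n. diam \<rho> X) \<longlonglongrightarrow> 0)"

text \<open>It is not required that \<open>d\<close> induces the topology; for expanding Thurston maps this is a
  consequence of the estimates.\<close>

definition visual_metric ::
  "'a::topological_space chart set \<Rightarrow> ('a \<Rightarrow> 'a) \<Rightarrow> ('a \<Rightarrow> 'a \<Rightarrow> real) \<Rightarrow> real \<Rightarrow> bool" where
  "visual_metric A f d \<Lambda> \<longleftrightarrow>
     Metric_space UNIV d \<and> \<Lambda> > 1 \<and>
     (\<exists>C. Jordan_curve C \<and> post A f \<subseteq> C \<and>
        (\<exists>K\<ge>1. \<forall>n.
           (\<forall>\<sigma>\<in>cells A f C n. \<forall>\<tau>\<in>cells A f C n. \<sigma> \<inter> \<tau> = {} \<longrightarrow>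
              set_dist d \<sigma> \<tau> \<ge> ereal (inverse K * \<Lambda> powi (- int n))) \<and>
           (\<forall>\<tau>\<in>edges A f C n \<union> tiles f C n.
              ereal (inverse K * \<Lambda> powi (- int n)) \<le> diam d \<tau> \<and>
              diam d \<tau> \<le> ereal (K * \<Lambda> powi (- int n)))))"

end

theory Submission
  imports Defs
begin

text \<open>
  Let \<open>x\<close> return within distance \<open>\<delta>\<close> of itself after \<open>l\<close> steps. The idea is to follow the orbit
  backwards. As \<open>f ^^ l\<close> expands distances by a factor of order \<open>\<Lambda>\<^bsup>l\<^esup>\<close>, the point \<open>x\<close>, being close to
  \<open>(f ^^ l) x\<close>, has a preimage \<open>z\<^sub>1\<close> under \<open>f ^^ l\<close> whose distance to \<open>x\<close> is at most of order
  \<open>\<delta> \<Lambda>\<^bsup>-l\<^esup>\<close>; then \<open>z\<^sub>1\<close> has a preimage \<open>z\<^sub>2\<close> still closer to \<open>z\<^sub>1\<close>, and so on. The sequence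
  converges geometrically, its limit is fixed by \<open>f ^^ l\<close>, and the sum of the series gives the bound
  on the distance between the orbits.

  One cannot do this with the metric alone, since a single pull-back loses a constant factor, and
  these factors would outweigh the contraction when \<open>l\<close> is small. Closeness is therefore measured by
  tiles: two points are near at level \<open>n\<close> if they lie in intersecting \<open>n\<close>-tiles. The estimates of a visual metric translate
  between nearness at level \<open>n\<close> and distances of order \<open>\<Lambda>\<^bsup>-n\<^esup>\<close> (\<open>near_imp_dist\<close>, \<open>dist_imp_near\<close>),
  whereas \<open>f ^^ k\<close> relates the levels \<open>n + k\<close> and \<open>n\<close> without any loss (\<open>near_forward\<close>, \<open>near_lift\<close>).
  The constants are thus paid once, at the beginning and at the end (\<open>near_closing\<close>, \<open>closing\<close>).

  Preimages of tiles are again tiles because a branched covering is an open map with finite fibres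
  of a compact, locally connected space: each component of the preimage of a region maps onto
  the region (\<open>component_vimage_onto\<close>), and there are finitely many of them. At a branch point
  the lift of a tile is not unique, but any choice serves. The Jordan curve theorem enters to show
  that the tiles of each level are finite in number and cover the sphere
  (\<open>Jordan_curve_on_sphere\<close>, \<open>finite_tiles\<close>, \<open>Union_tiles\<close>); this also yields the completeness of the
  metric (\<open>Cauchy_sequence_limit\<close>).
\<close>

section \<open>Charts and branched coverings\<close>

lemma chart_discs:
  assumes "is_chart (U, \<phi>)" "x \<in> U" "open W" "x \<in> W"
  obtains s where "0 < s"
    and "open {p \<in> U. \<phi> p \<in> ball (\<phi> x) s}"
    and "connected {p \<in> U. \<phi> p \<in> ball (\<phi> x) s}"
    and "{p \<in> U. \<phi> p \<in> ball (\<phi> x) s} \<subseteq> W"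
    and "\<phi> ` {p \<in> U. \<phi> p \<in> ball (\<phi> x) s} = ball (\<phi> x) s"
proof -
  obtain h where U: "open U" and "open (\<phi> ` U)" and h: "homeomorphism U (\<phi> ` U) \<phi> h"
    using assms(1) by (auto simp: is_chart_def)
  have h\<phi>: "h (\<phi> p) = p" if "p \<in> U" for p
    using h that by (simp add: homeomorphism_def)
  have cont: "continuous_on U \<phi>" "continuous_on (\<phi> ` U) h"
    using h unfolding homeomorphism_def by blast+
  have "open (\<phi> ` U \<inter> h -` W)"
    using cont(2) \<open>open (\<phi> ` U)\<close> \<open>open W\<close> continuous_open_preimage by blast
  moreover have "\<phi> x \<in> \<phi> ` U \<inter> h -` W"
    using assms h\<phi> by auto
  ultimately obtain s where s: "0 < s" "ball (\<phi> x) s \<subseteq> \<phi> ` U \<inter> h -` W"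
    by (meson open_contains_ball)
  let ?N = "{p \<in> U. \<phi> p \<in> ball (\<phi> x) s}"
  have N: "?N = h ` ball (\<phi> x) s"
  proof (intro equalityI subsetI)
    fix p assume "p \<in> ?N" then show "p \<in> h ` ball (\<phi> x) s"
      using h\<phi>[of p] image_eqI[of p h "\<phi> p"] by simp
  next
    fix p assume "p \<in> h ` ball (\<phi> x) s"
    then obtain z where z: "z \<in> ball (\<phi> x) s" "p = h z" by blast
    then obtain p' where "p' \<in> U" "z = \<phi> p'" using s by blast
    then show "p \<in> ?N" using z h\<phi> by simp
  qed
  show thesis
  proof
    show "0 < s" by fact
    have "?N = U \<inter> \<phi> -` ball (\<phi> x) s" by auto
    then show "open ?N"
      using continuous_open_preimage[OF cont(1) U open_ball] by simp
    show "connected ?N"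
      unfolding N using cont(2) s
      by (intro connected_continuous_image continuous_on_subset[OF cont(2)]) auto
    show "?N \<subseteq> W" unfolding N using s by auto
    show "\<phi> ` ?N = ball (\<phi> x) s" using s by auto
  qed
qed

text \<open>
  The charts make the sphere locally connected, so components of open sets are open.
\<close>

lemma open_component_of_atlas:
  fixes A :: "'a::topological_space chart set"
    and W K :: "'a set"
  assumes "oriented_atlas A" "open W" "K \<in> components W"
  shows "open K"
proof (subst open_subopen, intro ballI)
  fix x assume "x \<in> K"
  then have "x \<in> W" using assms(3) in_components_subset by blast
  obtain U \<phi> where "(U, \<phi>) \<in> A" "x \<in> U"
    using assms(1) unfolding oriented_atlas_def by (metis UNIV_I UN_E prod.collapse)
  then have "is_chart (U, \<phi>)" using assms(1) by (auto simp: oriented_atlas_def)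
  then obtain s where s: "0 < s" "open {p \<in> U. \<phi> p \<in> ball (\<phi> x) s}"
    "connected {p \<in> U. \<phi> p \<in> ball (\<phi> x) s}" "{p \<in> U. \<phi> p \<in> ball (\<phi> x) s} \<subseteq> W"
    by (rule chart_discs[OF _ \<open>x \<in> U\<close> \<open>open W\<close> \<open>x \<in> W\<close>])
  let ?N = "{p \<in> U. \<phi> p \<in> ball (\<phi> x) s}"
  have "x \<in> ?N" using s(1) \<open>x \<in> U\<close> by simp
  then have "K \<inter> ?N \<noteq> {}" using \<open>x \<in> K\<close> by blast
  then have "?N \<subseteq> K" by (rule components_maximal[OF assms(3) s(3,4)])
  then show "\<exists>T. open T \<and> x \<in> T \<and> T \<subseteq> K" using s(2) \<open>x \<in> ?N\<close> by blast
qed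

text \<open>
  Both properties are those of \<open>z \<mapsto> z\<^sup>k\<close> on a disc about \<open>0\<close>: the image of the disc of
  radius \<open>s\<close> is the disc of radius \<open>s\<^sup>k\<close>, and a complex number has finitely many \<open>k\<close>-th roots.
\<close>

lemma has_power_form_local:
  assumes "has_power_form A f x k" "1 \<le> k" "open W" "x \<in> W"
  obtains N where "open N" "x \<in> N" "N \<subseteq> W" "open (f ` N)" "\<And>q. finite (N \<inter> f -` {q})"
proof -
  obtain U \<phi> V \<psi> where UV: "is_chart (U, \<phi>)" "is_chart (V, \<psi>)" "x \<in> U" "f ` U \<subseteq> V"
    "\<phi> x = 0" "\<psi> (f x) = 0" and pow: "\<And>p. p \<in> U \<Longrightarrow> \<psi> (f p) = \<phi> p ^ k"
    using assms(1) unfolding has_power_form_def positive_chart_def by blast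
  obtain s where s: "0 < s" "open {p \<in> U. \<phi> p \<in> ball 0 s}"
    "{p \<in> U. \<phi> p \<in> ball 0 s} \<subseteq> W" "\<phi> ` {p \<in> U. \<phi> p \<in> ball 0 s} = ball 0 s"
    by (rule chart_discs[OF UV(1,3) assms(3,4), unfolded UV(5)])
  let ?N = "{p \<in> U. \<phi> p \<in> ball 0 s}"
  obtain g h where gh: "homeomorphism U (\<phi> ` U) \<phi> g" "homeomorphism V (\<psi> ` V) \<psi> h"
    using UV(1,2) by (auto simp: is_chart_def)
  then have inj: "inj_on \<phi> U" "inj_on \<psi> V" and V: "continuous_on V \<psi>"
    by (auto simp: homeomorphism_def intro: inj_on_inverseI)
  have "open V" using UV(2) by (simp add: is_chart_def)
  have "f ` ?N = V \<inter> \<psi> -` ball 0 (s ^ k)"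
  proof (intro equalityI subsetI)
    fix q assume "q \<in> f ` ?N"
    then show "q \<in> V \<inter> \<psi> -` ball 0 (s ^ k)"
      using UV(4) pow assms(2) by (auto simp: norm_power power_strict_mono)
  next
    fix q assume q: "q \<in> V \<inter> \<psi> -` ball 0 (s ^ k)"
    obtain z where z: "z ^ k = \<psi> q"
      using assms(2) by (metis exists_complex_root not_one_le_zero)
    have "norm z ^ k < s ^ k" using q z by (simp add: norm_power[symmetric])
    then have "z \<in> ball 0 s" using s(1) power_less_imp_less_base[of "norm z" k s] by simp
    then obtain p where p: "p \<in> ?N" "\<phi> p = z" using s(4) by (metis (no_types, lifting) imageE)
    then have "\<psi> (f p) = \<psi> q" "f p \<in> V" using pow z UV(4) by auto
    then have "f p = q" using inj(2) q by (simp add: inj_on_def)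
    then show "q \<in> f ` ?N" using p by blast
  qed
  then have "open (f ` ?N)" using continuous_open_preimage[OF V \<open>open V\<close> open_ball] by simp
  moreover have "finite (?N \<inter> f -` {q})" for q
  proof (rule finite_imageD)
    have "\<phi> ` (?N \<inter> f -` {q}) \<subseteq> {z. z ^ k = \<psi> q}" using pow by auto
    then show "finite (\<phi> ` (?N \<inter> f -` {q}))"
      using assms(2) finite_nth_roots[of k "\<psi> q"] finite_subset by auto
    show "inj_on \<phi> (?N \<inter> f -` {q})"
      using inj(1) by (rule inj_on_subset) auto
  qed
  ultimately show thesis using that[of ?N] s UV(3,5) by auto
qed

lemma branched_covering_open:
  assumes "branched_covering A f" "open W"
  shows "open (f ` W)"
proof (subst open_subopen, intro ballI)
  fix y assume "y \<in> f ` W"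
  then obtain x where x: "x \<in> W" "y = f x" by blast
  obtain k where "k \<ge> 1" "has_power_form A f x k"
    using assms(1) unfolding branched_covering_def by blast
  then obtain N where "x \<in> N" "N \<subseteq> W" "open (f ` N)"
    using has_power_form_local[OF _ _ assms(2) x(1)] by metis
  then show "\<exists>T. open T \<and> y \<in> T \<and> T \<subseteq> f ` W" using x by blast
qed

lemma branched_covering_finite_fibre:
  fixes A :: "'a::topological_space chart set"
  assumes "branched_covering A f" "compact (UNIV :: 'a set)"
  shows "finite (f -` {q})"
proof -
  have "\<exists>N. open N \<and> x \<in> N \<and> finite (N \<inter> f -` {q})" for x
  proof -
    obtain k where "k \<ge> 1" "has_power_form A f x k"
      using assms(1) unfolding branched_covering_def by blast
    then show ?thesis
      using has_power_form_local[OF _ _ open_UNIV UNIV_I] by metis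
  qed
  then obtain N where N: "\<And>x. open (N x) \<and> x \<in> N x \<and> finite (N x \<inter> f -` {q})"
    by metis
  then have open_N: "\<And>x. x \<in> UNIV \<Longrightarrow> open (N x)" and cover: "UNIV \<subseteq> (\<Union>x\<in>UNIV. N x)"
    by auto
  obtain D where "finite D" and D: "UNIV \<subseteq> (\<Union>x\<in>D. N x)"
    by (rule compactE_image[OF assms(2) open_N cover])
  then have "finite (\<Union>x\<in>D. N x \<inter> f -` {q})" using N by blast
  moreover have "f -` {q} \<subseteq> (\<Union>x\<in>D. N x \<inter> f -` {q})" using D by auto
  ultimately show ?thesis by (rule finite_subset[rotated])
qed

section \<open>Complements of Jordan curves in the sphere\<close>

lemma finite_components_Union:
  assumes "finite F" "\<And>T. T \<in> F \<Longrightarrow> connected T"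
  shows "finite (components (\<Union>F))"
proof -
  have "\<exists>T\<in>F. T \<noteq> {} \<and> T \<subseteq> K" if K: "K \<in> components (\<Union>F)" for K
  proof -
    obtain x where "x \<in> K" using in_components_nonempty[OF K] by blast
    then obtain T where "T \<in> F" "x \<in> T" using in_components_subset[OF K] by blast
    then show ?thesis using components_maximal[OF K, of T] assms(2) \<open>x \<in> K\<close> by blast
  qed
  then obtain t where t: "\<And>K. K \<in> components (\<Union>F) \<Longrightarrow> t K \<in> F \<and> t K \<noteq> {} \<and> t K \<subseteq> K"
    by metis
  have "inj_on t (components (\<Union>F))"
  proof (rule inj_onI)
    fix K L assume KL: "K \<in> components (\<Union>F)" "L \<in> components (\<Union>F)" "t K = t L"
    then have "K \<inter> L \<noteq> {}" using t[of K] t[of L] by auto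
    then show "K = L" using KL components_eq by blast
  qed
  moreover have "t ` components (\<Union>F) \<subseteq> F" using t by auto
  ultimately show ?thesis using inj_on_finite assms(1) by metis
qed

lemma circle_is_simple_loop:
  fixes S :: "complex set"
  assumes "S homeomorphic sphere (0::complex) 1"
  obtains c where "simple_path c" "pathfinish c = pathstart c" "path_image c = S"
proof -
  obtain h h' where h: "homeomorphism (sphere (0::complex) 1) S h h'"
    using homeomorphic_sym[THEN iffD1, OF assms] unfolding homeomorphic_def by blast
  let ?c = "h \<circ> circlepath 0 1"
  have 1: "path_image (circlepath 0 1) = sphere (0::complex) 1" by simp
  have "simple_path ?c"
  proof -
    have "inj_on h (path_image (circlepath 0 1))"
      using h unfolding homeomorphism_def inj_on_def 1 by metis
    moreover have "continuous_on (path_image (circlepath 0 1)) h"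
      using h unfolding homeomorphism_def 1 by simp
    moreover have "simple_path (circlepath 0 1)" by (simp add: simple_path_circlepath)
    ultimately show ?thesis using simple_path_continuous_image by blast
  qed
  moreover have "pathfinish ?c = pathstart ?c" by (simp add: pathfinish_compose pathstart_compose)
  moreover have "path_image ?c = S"
    using h unfolding path_image_compose 1 by (simp add: homeomorphism_def)
  ultimately show thesis using that by blast
qed

text \<open>
  Removing a point \<open>c\<close> off the curve turns the sphere into the plane, where the Jordan curve
  theorem applies: the complement of \<open>C\<close> consists of the images of the two planar components
  and of the point \<open>c\<close>. These three connected sets suffice for finiteness, although \<open>c\<close> in
  fact belongs to the outer component. The complement is dense because \<open>C\<close> corresponds to the
  frontier of a planar component.
\<close>

lemma Jordan_curve_on_sphere:
  fixes C :: "'a::topological_space set"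
  assumes sphere: "(UNIV :: 'a set) homeomorphic sphere (0 :: real ^ 3) 1" and C: "Jordan_curve C"
  shows "finite (components (- C))" and "closure (- C) = UNIV"
proof -
  obtain h h' where h: "homeomorphism (UNIV :: 'a set) (sphere (0 :: real ^ 3) 1) h h'"
    using sphere unfolding homeomorphic_def by blast
  \<comment> \<open>The sphere is simply connected and the circle is not.\<close>
  have "C \<noteq> UNIV"
  proof
    assume "C = UNIV"
    then have "sphere (0 :: real ^ 3) 1 homeomorphic sphere (0 :: complex) 1"
      using homeomorphic_trans[OF homeomorphic_sym[THEN iffD1, OF sphere]] C unfolding Jordan_curve_def by simp
    then show False
      using homeomorphic_simply_connected_eq[of "sphere (0 :: real ^ 3) 1" "sphere (0 :: complex) 1"]
      by (simp add: simply_connected_sphere_eq)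
  qed
  then obtain c where c: "c \<notin> C" by blast
  have "h c \<in> sphere 0 1" using h unfolding homeomorphism_def by blast
  then have "sphere (0 :: real ^ 3) 1 - {h c} homeomorphic (UNIV :: complex set)"
    using homeomorphic_punctured_affine_sphere_affine[of 1 "h c" "0::real^3" UNIV "UNIV::complex set"]
    by simp
  moreover have "(UNIV - {c}) homeomorphic sphere (0 :: real ^ 3) 1 - {h c}"
  proof -
    have "homeomorphism (UNIV - {c}) (h ` (UNIV - {c})) h h'"
      by (rule homeomorphism_of_subsets[OF h]) (use h in \<open>auto simp: homeomorphism_def\<close>)
    moreover have "h ` (UNIV - {c}) = sphere (0 :: real ^ 3) 1 - {h c}"
    proof -
      have "inj h" "h ` UNIV = sphere (0 :: real ^ 3) 1"
        using h by (auto simp: homeomorphism_def intro: inj_on_inverseI)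
      then show ?thesis using image_set_diff[of h UNIV "{c}"] by simp
    qed
    ultimately show ?thesis unfolding homeomorphic_def by metis
  qed
  ultimately have "(UNIV - {c}) homeomorphic (UNIV :: complex set)"
    using homeomorphic_trans by metis
  then obtain g g' where g: "homeomorphism (UNIV - {c}) (UNIV :: complex set) g g'"
    unfolding homeomorphic_def by blast
  have g'g: "g' (g p) = p" if "p \<noteq> c" for p using g that by (simp add: homeomorphism_def)
  have gg': "g (g' z) = z" for z using g by (simp add: homeomorphism_def)
  have g'c: "g' z \<noteq> c" for z using g unfolding homeomorphism_def by blast
  have contg': "continuous_on UNIV g'" using g by (simp add: homeomorphism_def)
  have "homeomorphism C (g ` C) g g'"
    by (rule homeomorphism_of_subsets[OF g]) (use c in blast)+
  then have "C homeomorphic g ` C" unfolding homeomorphic_def by blast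
  then have "g ` C homeomorphic sphere (0 :: complex) 1"
    using homeomorphic_trans[OF homeomorphic_sym[THEN iffD1]] C unfolding Jordan_curve_def by metis
  then obtain \<gamma> where \<gamma>: "simple_path \<gamma>" "pathfinish \<gamma> = pathstart \<gamma>" "path_image \<gamma> = g ` C"
    by (rule circle_is_simple_loop)
  obtain I J where IJ: "connected I" "connected J" "I \<union> J = - g ` C" "frontier I = g ` C"
    using Jordan_curve[OF \<gamma>(1,2)] \<gamma>(3) by metis
  have compl: "- C = \<Union>{g' ` I, g' ` J, {c}}"
  proof (intro equalityI subsetI)
    fix p assume p: "p \<in> - C"
    show "p \<in> \<Union>{g' ` I, g' ` J, {c}}"
    proof (cases "p = c")
      case False
      then have "g p \<notin> g ` C" using p c g'g by (metis ComplD imageE)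
      then show ?thesis using IJ(3) g'g[OF False] by (metis ComplI UnE Union_iff image_eqI insertCI)
    qed simp
  next
    fix p assume "p \<in> \<Union>{g' ` I, g' ` J, {c}}"
    moreover have "g' z \<notin> C" if "z \<in> I \<union> J" for z
      using that IJ(3) gg' by (metis ComplD image_eqI)
    ultimately show "p \<in> - C" using c by auto
  qed
  have conn: "connected (g' ` I)" "connected (g' ` J)"
    using IJ(1,2) continuous_on_subset[OF contg' subset_UNIV] connected_continuous_image by blast+
  show "finite (components (- C))"
    unfolding compl using conn by (intro finite_components_Union) auto
  have "C \<subseteq> closure (- C)"
  proof
    fix p assume "p \<in> C"
    then have "g p \<in> closure I" using IJ(4) by (auto simp: frontier_def)
    then have "g' (g p) \<in> closure (g' ` I)"
      using image_closure_subset[OF continuous_on_subset[OF contg' subset_UNIV] closed_closure closure_subset]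
      by blast
    moreover have "g' ` I \<subseteq> - C" unfolding compl by blast
    ultimately show "p \<in> closure (- C)"
      using g'g[of p] c \<open>p \<in> C\<close> closure_mono by (metis subsetD)
  qed
  then show "closure (- C) = UNIV" using closure_subset by blast
qed

lemma sphere_compact:
  assumes "(UNIV :: 'a::topological_space set) homeomorphic sphere (0 :: real ^ 3) 1"
  shows "compact (UNIV :: 'a set)"
  using assms homeomorphic_compactness compact_sphere by blast

lemma sphere_compact_imp_closed:
  assumes "(UNIV :: 'a::topological_space set) homeomorphic sphere (0 :: real ^ 3) 1" "compact K"
  shows "closed (K :: 'a set)"
proof -
  obtain h h' where h: "homeomorphism (UNIV :: 'a set) (sphere (0 :: real ^ 3) 1) h h'"
    using assms(1) unfolding homeomorphic_def by blast
  have cont: "continuous_on UNIV h" and inj: "\<And>x. h' (h x) = x"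
    using h by (simp_all add: homeomorphism_def)
  have "compact (h ` K)"
    using compact_continuous_image[OF continuous_on_subset[OF cont subset_UNIV] assms(2)] .
  then have "closed (UNIV \<inter> h -` (h ` K))"
    by (intro continuous_closed_preimage[OF cont closed_UNIV] compact_imp_closed)
  moreover have "UNIV \<inter> h -` (h ` K) = K" using inj by auto (metis inj)
  ultimately show ?thesis by simp
qed

section \<open>Tiles of an open map with finite fibres\<close>

text \<open>
  The setting in which tiles behave well under iteration. The assumptions on the underlying space
  say that it is compact and locally connected, and that compact sets are closed in it. The
  set \<open>C\<close> stands for a Jordan curve on the sphere: it is a closed nowhere dense set whose
  complement has finitely many components.
\<close>

locale open_sphere_map =
  fixes f :: "'a::topological_space \<Rightarrow> 'a" and C :: "'a set"
  assumes compact_space: "compact (UNIV :: 'a set)"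
    and compact_closed: "\<And>K :: 'a set. compact K \<Longrightarrow> closed K"
    and open_component: "\<And>W K :: 'a set. open W \<Longrightarrow> K \<in> components W \<Longrightarrow> open K"
    and continuous: "continuous_on UNIV f"
    and open_image: "\<And>W. open W \<Longrightarrow> open (f ` W)"
    and finite_fibre: "\<And>q. finite (f -` {q})"
    and finite_components: "finite (components (- C))"
    and dense_complement: "closure (- C) = UNIV"
    and closed_curve: "closed C"
begin

lemma closure_finite_Union:
  fixes F :: "'a set set"
  shows "finite F \<Longrightarrow> closure (\<Union>F) = \<Union>(closure ` F)"
  by (induction F rule: finite_induct) auto

lemma continuous_funpow: "continuous_on UNIV (f ^^ n)"
proof (induction n)
  case (Suc n)
  then have "continuous_on UNIV (f \<circ> f ^^ n)"
    using continuous by (blast intro: continuous_on_compose continuous_on_subset)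
  then show ?case by simp
qed (simp add: id_def)

lemma open_vimage_funpow: "open W \<Longrightarrow> open ((f ^^ n) -` W)"
  using continuous_funpow[of n] continuous_on_open_vimage[OF open_UNIV] by auto

lemma open_image_funpow: "open W \<Longrightarrow> open ((f ^^ n) ` W)"
proof (induction n)
  case (Suc n)
  then have "open (f ` (f ^^ n) ` W)" using open_image by blast
  then show ?case by (simp add: image_comp)
qed simp

lemma closed_image_funpow:
  assumes "closed X"
  shows "closed ((f ^^ n) ` X)"
proof -
  have "compact X" using compact_Int_closed[OF compact_space assms] by simp
  then have "compact ((f ^^ n) ` X)"
    using continuous_on_subset[OF continuous_funpow] by (intro compact_continuous_image) simp_all
  then show ?thesis by (rule compact_closed)
qed

lemma finite_fibre_funpow: "finite ((f ^^ n) -` {q})"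
proof (induction n arbitrary: q)
  case (Suc n)
  have "(f ^^ Suc n) -` {q} = (\<Union>p \<in> f -` {q}. (f ^^ n) -` {p})" by auto
  then show ?case using Suc finite_fibre by (metis finite_UN)
qed (simp add: vimage_def)

lemma vimage_closure_funpow: "(f ^^ n) -` closure U \<subseteq> closure ((f ^^ n) -` U)"
proof
  fix p assume p: "p \<in> (f ^^ n) -` closure U"
  show "p \<in> closure ((f ^^ n) -` U)"
    unfolding closure_iff_nhds_not_empty
  proof (intro allI impI)
    fix N W assume "W \<subseteq> N" "p \<in> W" "open W"
    then have "(f ^^ n) ` W \<inter> U \<noteq> {}"
      using p open_image_funpow[of W n] open_Int_closure_eq_empty[of "(f ^^ n) ` W" U] by auto
    then show "(f ^^ n) -` U \<inter> N \<noteq> {}" using \<open>W \<subseteq> N\<close> by auto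
  qed
qed

text \<open>
  The restriction of an iterate \<open>g\<close> to the preimage of a component \<open>U\<close> of \<open>V\<close> is open and proper.
  Hence the image of a component \<open>K\<close> of this preimage is open, and closed relative to \<open>U\<close>: a
  point of the closure of \<open>K\<close> that \<open>g\<close> maps into \<open>U\<close> lies in an open component of the preimage,
  which then meets \<open>K\<close> and so equals it. By connectedness the image is all of \<open>U\<close>.
\<close>

lemma component_vimage_onto:
  assumes "open V" "K \<in> components ((f ^^ n) -` V)"
  shows "(f ^^ n) ` K \<in> components V"
proof -
  let ?g = "f ^^ n"
  have K: "open K" "connected K" "K \<noteq> {}" "K \<subseteq> ?g -` V"
    using open_component[OF open_vimage_funpow[OF assms(1)] assms(2)]
      in_components_connected[OF assms(2)] in_components_nonempty[OF assms(2)]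
      in_components_subset[OF assms(2)] by simp_all
  have conn: "connected (?g ` K)"
    by (rule connected_continuous_image[OF continuous_on_subset[OF continuous_funpow] K(2)]) simp
  have "?g ` K \<subseteq> V" "V \<noteq> {}" using K(3,4) by auto
  then obtain U where U: "U \<in> components V" "?g ` K \<subseteq> U"
    using exists_component_superset[OF _ _ conn] by metis
  have "?g ` closure K \<inter> U \<subseteq> ?g ` K"
  proof clarify
    fix p assume p: "p \<in> closure K" "?g p \<in> U"
    then have "p \<in> ?g -` V" using U in_components_subset by blast
    then obtain L where L: "L \<in> components (?g -` V)" "p \<in> L"
      by (metis UnionE Union_components)
    moreover have "open L" by (rule open_component[OF open_vimage_funpow[OF assms(1)] L(1)])
    ultimately have "L \<inter> K \<noteq> {}" using p(1) open_Int_closure_eq_empty[of L K] by auto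
    then have "L = K" using components_eq[OF L(1) assms(2)] by simp
    then show "?g p \<in> ?g ` K" using L by blast
  qed
  then have eq: "?g ` K = U \<inter> ?g ` closure K" using U(2) closure_subset[of K] by blast
  have "closed (?g ` closure K)" using closed_image_funpow by simp
  then have "closedin (top_of_set U) (?g ` K)" unfolding eq by (rule closedin_closed_Int)
  moreover have "openin (top_of_set U) (?g ` K)"
    using open_image_funpow[OF K(1)] U(2) by (simp add: open_subset)
  ultimately have "?g ` K = U"
    using in_components_connected[OF U(1)] K(3) unfolding connected_clopen by (metis image_is_empty)
  then show ?thesis using U by simp
qed

text \<open>
  Each component of the preimage maps onto a component of \<open>V\<close>, so it contains a point of the
  fibre over a point chosen in that component. These fibres are finite.
\<close>

lemma finite_components_vimage:
  assumes "open V" "finite (components V)"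
  shows "finite (components ((f ^^ n) -` V))"
proof -
  let ?g = "f ^^ n"
  let ?P = "\<Union>U\<in>components V. ?g -` {SOME u. u \<in> U}"
  have "components (?g -` V) \<subseteq> connected_component_set (?g -` V) ` ?P"
  proof
    fix K assume K: "K \<in> components (?g -` V)"
    then have U: "?g ` K \<in> components V" using component_vimage_onto[OF assms(1)] by simp
    then have "(SOME u. u \<in> ?g ` K) \<in> ?g ` K"
      using in_components_nonempty[OF U] by (simp only: some_in_eq not_False_eq_True)
    then obtain p where p: "p \<in> K" "?g p = (SOME u. u \<in> ?g ` K)" by auto
    then have "p \<in> ?P" using U by auto
    moreover have "K = connected_component_set (?g -` V) p"
      using components_iff[THEN iffD1, OF K] connected_component_eq[of p "?g -` V"] p(1) by metis
    ultimately show "K \<in> connected_component_set (?g -` V) ` ?P" by blast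
  qed
  moreover have "finite ?P" using assms(2) finite_fibre_funpow by (rule finite_UN_I)
  ultimately show ?thesis by (rule finite_surj[rotated])
qed

text \<open>
  Openness puts \<open>p\<close> in the closure of the preimage of \<open>U\<close>. As this preimage has only finitely many
  components, \<open>p\<close> is in the closure of one of them.
\<close>

lemma vimage_component_closure:
  assumes "open V" "finite (components V)" "U \<in> components V" "(f ^^ n) p \<in> closure U"
  obtains K where "K \<in> components ((f ^^ n) -` V)" "p \<in> closure K" "(f ^^ n) ` K = U"
proof -
  let ?g = "f ^^ n"
  let ?F = "{K \<in> components (?g -` V). ?g ` K = U}"
  have "?g -` U \<subseteq> \<Union>?F"
  proof
    fix p assume p: "p \<in> ?g -` U"
    then have "p \<in> ?g -` V" using in_components_subset[OF assms(3)] by auto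
    then obtain K where K: "K \<in> components (?g -` V)" "p \<in> K"
      by (metis UnionE Union_components)
    have "?g ` K \<in> components V" by (rule component_vimage_onto[OF assms(1) K(1)])
    moreover have "?g ` K \<inter> U \<noteq> {}" using p K(2) by auto
    ultimately have "?g ` K = U" using components_eq assms(3) by metis
    then show "p \<in> \<Union>?F" using K by blast
  qed
  moreover have "p \<in> closure (?g -` U)" using assms(4) vimage_closure_funpow[of n U] by auto
  ultimately have "p \<in> closure (\<Union>?F)" using closure_mono[of "?g -` U" "\<Union>?F"] by auto
  moreover have "finite ?F" using finite_components_vimage[OF assms(1,2)] by simp
  ultimately have "p \<in> \<Union>(closure ` ?F)" by (simp add: closure_finite_Union)
  then show thesis using that by blast
qed

lemma tiles_alt: "tiles f C n = closure ` components ((f ^^ n) -` (- C))"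
  by (simp add: tiles_def Compl_eq_Diff_UNIV vimage_Diff)

lemma open_complement: "open (- C)" using closed_curve by blast

lemma finite_tiles: "finite (tiles f C n)"
  unfolding tiles_alt using finite_components_vimage[OF open_complement finite_components] by blast

lemma Union_tiles: "\<Union>(tiles f C n) = UNIV"
proof -
  have "\<Union>(tiles f C n) = closure ((f ^^ n) -` (- C))"
    unfolding tiles_alt using finite_components_vimage[OF open_complement finite_components, of n]
    by (metis Union_components closure_finite_Union)
  also have "\<dots> = UNIV" using vimage_closure_funpow[of n "- C"] dense_complement by auto
  finally show ?thesis .
qed

text \<open>
  Tiles of level \<open>n + k\<close> lie over tiles of level \<open>n\<close>, and conversely every tile of level \<open>n\<close> lifts
  through any preimage of any of its points, boundary points included. Such a lift need not be
  unique.
\<close>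

lemma tile_forward:
  assumes "X \<in> tiles f C (n + k)"
  obtains Y where "Y \<in> tiles f C n" "(f ^^ k) ` X \<subseteq> Y"
proof -
  have eq: "(f ^^ (n + k)) -` (- C) = (f ^^ k) -` ((f ^^ n) -` (- C))"
    by (auto simp: funpow_add)
  obtain K where K: "K \<in> components ((f ^^ (n + k)) -` (- C))" "X = closure K"
    using assms unfolding tiles_alt by blast
  have "(f ^^ k) ` K \<in> components ((f ^^ n) -` (- C))"
    using component_vimage_onto[OF open_vimage_funpow[OF open_complement]] K(1) unfolding eq by simp
  then have "closure ((f ^^ k) ` K) \<in> tiles f C n" unfolding tiles_alt by simp
  moreover have "(f ^^ k) ` X \<subseteq> closure ((f ^^ k) ` K)"
    unfolding K(2)
    by (rule image_closure_subset[OF continuous_on_subset[OF continuous_funpow] closed_closure closure_subset])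
      simp
  ultimately show thesis by (rule that)
qed

lemma tile_lift:
  assumes "Y \<in> tiles f C n" "(f ^^ k) p \<in> Y"
  obtains X where "X \<in> tiles f C (n + k)" "p \<in> X" "Y \<subseteq> (f ^^ k) ` X"
proof -
  have eq: "(f ^^ (n + k)) -` (- C) = (f ^^ k) -` ((f ^^ n) -` (- C))"
    by (auto simp: funpow_add)
  obtain U where U: "U \<in> components ((f ^^ n) -` (- C))" "Y = closure U"
    using assms unfolding tiles_alt by blast
  have p: "(f ^^ k) p \<in> closure U" using assms(2) U(2) by simp
  obtain K where K: "K \<in> components ((f ^^ (n + k)) -` (- C))" "p \<in> closure K" "(f ^^ k) ` K = U"
    by (rule vimage_component_closure[OF open_vimage_funpow[OF open_complement]
          finite_components_vimage[OF open_complement finite_components] U(1) p, folded eq])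
  have "closed ((f ^^ k) ` closure K)" using closed_image_funpow by simp
  moreover have "U \<subseteq> (f ^^ k) ` closure K" using K(3) closure_subset[of K] by blast
  ultimately have "Y \<subseteq> (f ^^ k) ` closure K" unfolding U(2) by (simp add: closure_minimal)
  moreover have "closure K \<in> tiles f C (n + k)" using K(1) unfolding tiles_alt by simp
  ultimately show thesis using that K(2) by simp
qed

text \<open>
  This is how topological accumulation becomes metric accumulation: \<open>N\<close> is covered by tiles
  through \<open>y\<close>, and a visual metric controls the diameters of tiles. To obtain \<open>N\<close>, remove the
  finitely many tiles that miss \<open>y\<close>; they are closed.
\<close>

lemma tile_neighbourhood:
  obtains N where "open N" "y \<in> N" "\<forall>w\<in>N. \<exists>X\<in>tiles f C n. y \<in> X \<and> w \<in> X"
proof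
  let ?N = "- \<Union>{X \<in> tiles f C n. y \<notin> X}"
  have "closed X" if "X \<in> tiles f C n" for X using that unfolding tiles_alt by auto
  then show "open ?N" using finite_tiles[of n] by (intro open_Compl closed_Union) auto
  show "y \<in> ?N" by blast
  show "\<forall>w\<in>?N. \<exists>X\<in>tiles f C n. y \<in> X \<and> w \<in> X"
  proof
    fix w assume w: "w \<in> ?N"
    have "w \<in> \<Union>(tiles f C n)" using Union_tiles[of n] by simp
    then obtain X where "X \<in> tiles f C n" "w \<in> X" by (rule UnionE)
    moreover from this have "y \<in> X" using w by auto
    ultimately show "\<exists>X\<in>tiles f C n. y \<in> X \<and> w \<in> X" by blast
  qed
qed

text \<open>
  A discrete substitute for \<open>d x y\<close> being at most of the order of \<open>\<Lambda>\<^bsup>-n\<^esup>\<close>. It is used instead of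
  membership in a common tile because nearby points may lie in different tiles.
\<close>

definition near :: "nat \<Rightarrow> 'a \<Rightarrow> 'a \<Rightarrow> bool" where
  "near n x y \<longleftrightarrow> (\<exists>X\<in>tiles f C n. \<exists>Y\<in>tiles f C n. x \<in> X \<and> y \<in> Y \<and> X \<inter> Y \<noteq> {})"

lemma near_forward:
  assumes "near (n + k) x y"
  shows "near n ((f ^^ k) x) ((f ^^ k) y)"
proof -
  obtain X Y where XY: "X \<in> tiles f C (n + k)" "Y \<in> tiles f C (n + k)" "x \<in> X" "y \<in> Y" "X \<inter> Y \<noteq> {}"
    using assms unfolding near_def by blast
  obtain X' where X': "X' \<in> tiles f C n" "(f ^^ k) ` X \<subseteq> X'" using tile_forward[OF XY(1)] .
  obtain Y' where Y': "Y' \<in> tiles f C n" "(f ^^ k) ` Y \<subseteq> Y'" using tile_forward[OF XY(2)] .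
  have "X' \<inter> Y' \<noteq> {}" using XY(5) X'(2) Y'(2) by (auto simp: image_subset_iff)
  moreover have "(f ^^ k) x \<in> X'" "(f ^^ k) y \<in> Y'" using X'(2) Y'(2) XY(3,4) by auto
  ultimately show ?thesis unfolding near_def using X'(1) Y'(1) by metis
qed

text \<open>
  Given a chain of two intersecting tiles from \<open>(f ^^ k) x\<close> to \<open>b\<close>, lift the first tile through \<open>x\<close>,
  pick a preimage of the intersection point in the lift, and lift the second tile through it.
\<close>

lemma near_lift:
  assumes "near n ((f ^^ k) x) b"
  obtains y where "(f ^^ k) y = b" "near (n + k) x y"
proof -
  obtain X Y c where XY: "X \<in> tiles f C n" "Y \<in> tiles f C n" "(f ^^ k) x \<in> X" "b \<in> Y"
    and c: "c \<in> X" "c \<in> Y"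
    using assms unfolding near_def by blast
  obtain X' where X': "X' \<in> tiles f C (n + k)" "x \<in> X'" "X \<subseteq> (f ^^ k) ` X'"
    using tile_lift[OF XY(1,3)] .
  then obtain c' where c': "c' \<in> X'" "c = (f ^^ k) c'" using c(1) by auto
  then have "(f ^^ k) c' \<in> Y" using c(2) by simp
  then obtain Y' where Y': "Y' \<in> tiles f C (n + k)" "c' \<in> Y'" "Y \<subseteq> (f ^^ k) ` Y'"
    by (rule tile_lift[OF XY(2)])
  then obtain y where "y \<in> Y'" "b = (f ^^ k) y" using XY(4) by auto
  moreover have "X' \<inter> Y' \<noteq> {}" using c'(1) Y'(2) by auto
  ultimately have "near (n + k) x y" unfolding near_def using X'(1,2) Y'(1) by metis
  then show thesis using that \<open>b = (f ^^ k) y\<close> by simp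
qed

end

section \<open>Metrics controlled by the tiles\<close>

text \<open>
  The part of the definition of a visual metric that concerns tiles, with \<open>q\<close> the inverse of the
  expansion factor.
\<close>

locale visual_sphere_map = open_sphere_map f C + Metric_space UNIV d
  for f :: "'a::topological_space \<Rightarrow> 'a" and C and d :: "'a \<Rightarrow> 'a \<Rightarrow> real" +
  fixes K q :: real
  assumes K_ge: "1 \<le> K" and q_pos: "0 < q" and q_less: "q < 1"
    and tile_diam: "\<And>n X x y. X \<in> tiles f C n \<Longrightarrow> x \<in> X \<Longrightarrow> y \<in> X \<Longrightarrow> d x y \<le> K * q ^ n"
    and tile_gap: "\<And>n X Y x y. X \<in> tiles f C n \<Longrightarrow> Y \<in> tiles f C n \<Longrightarrow> X \<inter> Y = {} \<Longrightarrow>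
      x \<in> X \<Longrightarrow> y \<in> Y \<Longrightarrow> q ^ n / K \<le> d x y"
begin

lemma near_imp_dist: "near n x y \<Longrightarrow> d x y \<le> 2 * K * q ^ n"
proof -
  assume "near n x y"
  then obtain X Y c where XY: "X \<in> tiles f C n" "Y \<in> tiles f C n" "x \<in> X" "y \<in> Y" "c \<in> X" "c \<in> Y"
    unfolding near_def by blast
  have "d x y \<le> d x c + d c y" using triangle by simp
  also have "\<dots> \<le> 2 * K * q ^ n"
    using tile_diam[OF XY(1,3,5)] tile_diam[OF XY(2,6,4)] by simp
  finally show ?thesis .
qed

lemma dist_imp_near: "d x y < q ^ n / K \<Longrightarrow> near n x y"
proof -
  assume less: "d x y < q ^ n / K"
  have "x \<in> \<Union>(tiles f C n)" "y \<in> \<Union>(tiles f C n)" using Union_tiles[of n] by simp_all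
  then obtain X Y where XY: "X \<in> tiles f C n" "Y \<in> tiles f C n" "x \<in> X" "y \<in> Y"
    by (elim UnionE)
  then have "X \<inter> Y \<noteq> {}" using tile_gap less by fastforce
  then show ?thesis unfolding near_def using XY by blast
qed

lemma scale_tendsto_zero: "(\<lambda>n. c * q ^ n) \<longlonglongrightarrow> 0"
  using q_pos q_less by (intro tendsto_mult_right_zero LIMSEQ_realpow_zero) auto

lemma small_scale:
  assumes "0 < e"
  obtains m where "c * q ^ m < e"
  using eventually_happens[OF order_tendstoD(2)[OF scale_tendsto_zero assms]] that by auto

text \<open>
  Iterates are continuous for \<open>d\<close>: an iterate lowers the level of nearness only by a fixed amount.
\<close>

lemma funpow_dist_tendsto:
  assumes "(\<lambda>j. d (z j) y) \<longlonglongrightarrow> 0"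
  shows "(\<lambda>j. d ((f ^^ i) (z j)) ((f ^^ i) y)) \<longlonglongrightarrow> 0"
proof (rule LIMSEQ_I)
  fix e :: real assume "0 < e"
  then obtain m where m: "2 * K * q ^ m < e" by (rule small_scale)
  have "0 < q ^ (m + i) / K" using K_ge q_pos by simp
  then obtain J where J: "\<And>j. J \<le> j \<Longrightarrow> d (z j) y < q ^ (m + i) / K"
    using order_tendstoD(2)[OF assms] eventually_sequentially by metis
  have "d ((f ^^ i) (z j)) ((f ^^ i) y) < e" if "J \<le> j" for j
    using near_imp_dist[OF near_forward[OF dist_imp_near[OF J[OF that]]]] m by simp
  then show "\<exists>J. \<forall>j\<ge>J. norm (d ((f ^^ i) (z j)) ((f ^^ i) y) - 0) < e" by auto
qed

text \<open>
  Completeness of \<open>d\<close>, in the form needed for sequences that converge geometrically. A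
  topological accumulation point exists by compactness, and it is a metric one because its
  neighbourhoods can be covered by small tiles containing it.
\<close>

lemma Cauchy_sequence_limit:
  assumes "\<And>a b. a \<le> b \<Longrightarrow> d (z a) (z b) \<le> B * q ^ a"
  obtains y where "(\<lambda>j. d (z j) y) \<longlonglongrightarrow> 0"
proof -
  have "\<exists>y. \<forall>N. open N \<longrightarrow> y \<in> N \<longrightarrow> infinite {j :: nat. z j \<in> N}"
  proof (rule ccontr)
    assume "\<not> ?thesis"
    then obtain N where N: "\<And>y. open (N y) \<and> y \<in> N y \<and> finite {j. z j \<in> N y}" by metis
    then have open_N: "\<And>y. y \<in> UNIV \<Longrightarrow> open (N y)" and cover: "UNIV \<subseteq> (\<Union>y\<in>UNIV. N y)"
      by auto
    obtain D where "finite D" and D: "UNIV \<subseteq> (\<Union>y\<in>D. N y)"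
      by (rule compactE_image[OF compact_space open_N cover])
    then have "finite (\<Union>y\<in>D. {j. z j \<in> N y})" using N by blast
    moreover have "(UNIV :: nat set) \<subseteq> (\<Union>y\<in>D. {j. z j \<in> N y})" using D by auto
    ultimately show False using finite_subset by auto
  qed
  then obtain y where y: "\<And>N. open N \<Longrightarrow> y \<in> N \<Longrightarrow> infinite {j. z j \<in> N}" by blast
  have bound: "d (z a) y \<le> (B + K) * q ^ a" for a
  proof -
    \<comment> \<open>At scale \<open>a\<close>, some later term shares a small tile with \<open>y\<close>.\<close>
    obtain N where N: "open N" "y \<in> N" "\<forall>w\<in>N. \<exists>X\<in>tiles f C a. y \<in> X \<and> w \<in> X"
      by (rule tile_neighbourhood[of y a])
    then obtain b where b: "a \<le> b" "z b \<in> N"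
      using y[OF N(1,2)] by (metis infinite_nat_iff_unbounded_le mem_Collect_eq)
    then have "d (z b) y \<le> K * q ^ a" using N(3) tile_diam by meson
    moreover have "d (z a) y \<le> d (z a) (z b) + d (z b) y" using triangle by simp
    ultimately show ?thesis using assms[OF b(1)] by (simp add: algebra_simps)
  qed
  have "(\<lambda>j. d (z j) y) \<longlonglongrightarrow> 0"
    by (rule tendsto_sandwich[OF _ _ tendsto_const scale_tendsto_zero[of "B + K"]])
      (use bound in auto)
  then show thesis using that by blast
qed

text \<open>
  A point that returns near itself after time \<open>l\<close> can be pulled back along its own orbit:
  \<open>z\<^sub>0 = x\<close> is near \<open>(f ^^ l) z\<^sub>0\<close> at level \<open>n\<close>, so it has an \<open>l\<close>-th preimage \<open>z\<^sub>1\<close> near \<open>z\<^sub>0\<close> at level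
  \<open>n + l\<close>, and so on. Nearness improves by \<open>l\<close> levels at each step, so the distances between
  consecutive points decay geometrically. The limit is fixed by \<open>f ^^ l\<close>, because \<open>f ^^ l\<close> shifts
  the sequence by one place. The same geometric series, read after \<open>i\<close> iterations, bounds the
  distance between the two orbits.
\<close>

lemma near_closing:
  assumes "1 \<le> l" and near: "near n ((f ^^ l) x) x"
  obtains y where "(f ^^ l) y = y"
    and "\<And>i. i \<le> l \<Longrightarrow> d ((f ^^ i) x) ((f ^^ i) y) \<le> 2 * K * q ^ (n + l - i) / (1 - q)"
proof -
  have "\<exists>z. \<forall>j. ((j = 0 \<longrightarrow> z j = x) \<and> near (n + j * l) ((f ^^ l) (z j)) (z j))
      \<and> (f ^^ l) (z (Suc j)) = z j"
  proof (rule dependent_nat_choice)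
    show "\<exists>w. (0 = (0::nat) \<longrightarrow> w = x) \<and> near (n + 0 * l) ((f ^^ l) w) w" using near by simp
  next
    fix w and j :: nat
    assume "(j = 0 \<longrightarrow> w = x) \<and> near (n + j * l) ((f ^^ l) w) w"
    then obtain v where v: "(f ^^ l) v = w" "near (n + j * l + l) w v"
      using near_lift by metis
    then have "near (n + Suc j * l) ((f ^^ l) v) v" by (simp add: algebra_simps)
    then show "\<exists>v. ((Suc j = 0 \<longrightarrow> v = x) \<and> near (n + Suc j * l) ((f ^^ l) v) v) \<and> (f ^^ l) v = w"
      using v by auto
  qed
  then obtain z where z0: "z 0 = x" and near_z: "\<And>j. near (n + j * l) ((f ^^ l) (z j)) (z j)"
    and z_Suc: "\<And>j. (f ^^ l) (z (Suc j)) = z j" by metis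
  have consecutive: "d ((f ^^ i) (z j)) ((f ^^ i) (z (Suc j))) \<le> 2 * K * q ^ (n + l - i) * q ^ j"
    if "i \<le> l" for i j
  proof -
    have "near (n + Suc j * l) (z j) (z (Suc j))" using near_z[of "Suc j"] z_Suc by simp
    moreover have "n + Suc j * l = (n + l - i + j * l) + i" using that by simp
    ultimately have "near (n + l - i + j * l) ((f ^^ i) (z j)) ((f ^^ i) (z (Suc j)))"
      using near_forward by metis
    then have "d ((f ^^ i) (z j)) ((f ^^ i) (z (Suc j))) \<le> 2 * K * q ^ (n + l - i + j * l)"
      by (rule near_imp_dist)
    also have "\<dots> \<le> 2 * K * q ^ (n + l - i + j)"
      using assms(1) q_pos q_less K_ge by (intro mult_left_mono power_decreasing) auto
    finally show ?thesis by (simp add: power_add mult.assoc)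
  qed
  have chain: "d ((f ^^ i) (z a)) ((f ^^ i) (z b)) \<le> 2 * K * q ^ (n + l - i) / (1 - q) * q ^ a"
    if "i \<le> l" "a \<le> b" for i a b
  proof -
    define M where "M = 2 * K * q ^ (n + l - i)"
    have "0 \<le> M" using K_ge q_pos by (simp add: M_def)
    \<comment> \<open>The difference of powers makes the bound additive along the chain.\<close>
    have "d ((f ^^ i) (z a)) ((f ^^ i) (z b)) \<le> M * (q ^ a - q ^ b) / (1 - q)"
      using that(2)
    proof (induction b rule: dec_induct)
      case base
      show ?case by simp
    next
      case (step b)
      have "d ((f ^^ i) (z a)) ((f ^^ i) (z (Suc b)))
          \<le> d ((f ^^ i) (z a)) ((f ^^ i) (z b)) + d ((f ^^ i) (z b)) ((f ^^ i) (z (Suc b)))"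
        using triangle by simp
      also have "\<dots> \<le> M * (q ^ a - q ^ b) / (1 - q) + M * q ^ b"
        using step.IH consecutive[OF that(1), of b]
        unfolding M_def by linarith
      also have "\<dots> = M * (q ^ a - q ^ Suc b) / (1 - q)"
        using q_less by (simp add: field_simps)
      finally show ?case .
    qed
    also have "\<dots> \<le> M * q ^ a / (1 - q)"
      using q_pos q_less \<open>0 \<le> M\<close> by (intro divide_right_mono mult_left_mono) auto
    finally show ?thesis by (simp add: M_def)
  qed
  have "d (z a) (z b) \<le> 2 * K * q ^ (n + l) / (1 - q) * q ^ a" if "a \<le> b" for a b
    using chain[of 0 a b] that by simp
  then obtain y where y: "(\<lambda>j. d (z j) y) \<longlonglongrightarrow> 0" using Cauchy_sequence_limit by metis
  show thesis
  proof
    have "(\<lambda>j. d ((f ^^ l) (z (Suc j))) ((f ^^ l) y)) \<longlonglongrightarrow> 0"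
      using LIMSEQ_Suc[OF funpow_dist_tendsto[OF y]] .
    then have lim: "(\<lambda>j. d (z j) ((f ^^ l) y) + d (z j) y) \<longlonglongrightarrow> 0 + 0"
      using y unfolding z_Suc by (intro tendsto_add)
    have "d ((f ^^ l) y) y \<le> d (z j) ((f ^^ l) y) + d (z j) y" for j
      using triangle[of "(f ^^ l) y" "z j" y] by (simp add: commute)
    then have "d ((f ^^ l) y) y \<le> 0" using LIMSEQ_le_const[OF lim] by simp
    then have "d ((f ^^ l) y) y = 0" using nonneg[of "(f ^^ l) y" y] by linarith
    then show "(f ^^ l) y = y" using zero[of "(f ^^ l) y" y] by simp
  next
    fix i assume "i \<le> l"
    have lim: "(\<lambda>j. 2 * K * q ^ (n + l - i) / (1 - q) + d ((f ^^ i) (z j)) ((f ^^ i) y))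
        \<longlonglongrightarrow> 2 * K * q ^ (n + l - i) / (1 - q) + 0"
      by (intro tendsto_add tendsto_const funpow_dist_tendsto y)
    have "d ((f ^^ i) x) ((f ^^ i) y) \<le> 2 * K * q ^ (n + l - i) / (1 - q) + d ((f ^^ i) (z j)) ((f ^^ i) y)" for j
    proof -
      have "d ((f ^^ i) x) ((f ^^ i) y) \<le> d ((f ^^ i) x) ((f ^^ i) (z j)) + d ((f ^^ i) (z j)) ((f ^^ i) y)"
        using triangle by simp
      then show ?thesis using chain[OF \<open>i \<le> l\<close>, of 0 j] z0 by simp
    qed
    then show "d ((f ^^ i) x) ((f ^^ i) y) \<le> 2 * K * q ^ (n + l - i) / (1 - q)"
      using LIMSEQ_le_const[OF lim] by simp
  qed
qed

text \<open>
  The level \<open>n\<close> is chosen with \<open>q\<^bsup>n+1\<^esup> / K \<le> \<delta> < q\<^bsup>n\<^esup> / K\<close>. The right inequality gives nearness at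
  level \<open>n\<close>, and the left one turns the resulting bound back into a multiple of \<open>\<delta>\<close>, at the cost of
  a factor \<open>K / q\<close>.
\<close>

lemma closing:
  assumes "1 \<le> l" "0 < \<delta>" "\<delta> < 1 / K" "d x ((f ^^ l) x) \<le> \<delta>"
  obtains y where "(f ^^ l) y = y"
    and "\<And>i. i \<le> l \<Longrightarrow> d ((f ^^ i) x) ((f ^^ i) y) \<le> 2 * K\<^sup>2 / (q * (1 - q)) * \<delta> * q ^ (l - i)"
proof -
  obtain m where "1 / K * q ^ m < \<delta>" using assms(2) by (rule small_scale)
  then have "q ^ m / K \<le> \<delta>" by simp
  then have ex: "\<exists>m. q ^ m / K \<le> \<delta>" by blast
  define m where "m = (LEAST m. q ^ m / K \<le> \<delta>)"
  have m: "q ^ m / K \<le> \<delta>" unfolding m_def using LeastI_ex[OF ex] .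
  \<comment> \<open>The least such exponent is positive as \<open>\<delta> < 1 / K\<close>, so that it has a predecessor \<open>n\<close>.\<close>
  have "m \<noteq> 0" using m assms(3) by (metis not_le power_0)
  then obtain n where n: "m = Suc n" using not0_implies_Suc by blast
  have "\<delta> < q ^ n / K"
    using not_less_Least[of n "\<lambda>m. q ^ m / K \<le> \<delta>"] n unfolding m_def by simp
  then have "near n ((f ^^ l) x) x" using assms(4) commute by (intro dist_imp_near) simp
  then obtain y where y: "(f ^^ l) y = y"
    "\<And>i. i \<le> l \<Longrightarrow> d ((f ^^ i) x) ((f ^^ i) y) \<le> 2 * K * q ^ (n + l - i) / (1 - q)"
    using near_closing assms(1) by metis
  have "q ^ n \<le> K * \<delta> / q" using m n K_ge q_pos by (simp add: field_simps)
  then have "2 * K * q ^ (n + l - i) / (1 - q) \<le> 2 * K\<^sup>2 / (q * (1 - q)) * \<delta> * q ^ (l - i)" if "i \<le> l" for i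
  proof -
    have "2 * K * q ^ (n + l - i) / (1 - q) = 2 * K * q ^ (l - i) / (1 - q) * q ^ n"
      using that by (simp add: power_add[symmetric] add.commute)
    also have "\<dots> \<le> 2 * K * q ^ (l - i) / (1 - q) * (K * \<delta> / q)"
      using \<open>q ^ n \<le> K * \<delta> / q\<close> K_ge q_pos q_less by (intro mult_left_mono) auto
    also have "\<dots> = 2 * K\<^sup>2 / (q * (1 - q)) * \<delta> * q ^ (l - i)" by (simp add: power2_eq_square mult_ac)
    finally show ?thesis .
  qed
  then show thesis using that y by (meson order_trans)
qed

end

section \<open>The closing lemma for visual metrics\<close>

theorem lemma8p6:
  fixes A :: "'a::topological_space chart set"
    and f :: "'a \<Rightarrow> 'a"
    and d :: "'a \<Rightarrow> 'a \<Rightarrow> real"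
    and \<Lambda> :: real
    and C :: "'a set"
  assumes "oriented_sphere A"
    and "Thurston_map A f"
    and "expanding A f"
    and "visual_metric A f d \<Lambda>"
    and "Jordan_curve C"
    and "post A f \<subseteq> C"
  shows "\<exists>\<beta>\<^sub>0>1. \<forall>\<eta>>0. \<exists>\<delta>\<^sub>3. 0 < \<delta>\<^sub>3 \<and> \<delta>\<^sub>3 < 1 \<and>
    (\<forall>\<delta>. 0 < \<delta> \<and> \<delta> \<le> \<delta>\<^sub>3 \<longrightarrow>
      (\<forall>x. \<forall>l::nat. l \<ge> 1 \<longrightarrow>
        d x ((f ^^ l) x) \<le> \<delta> \<longrightarrow>
        (\<forall>i\<le>l. point_dist d ((f ^^ i) x) (crit A f) \<ge> ereal \<eta>) \<longrightarrow>
        (\<exists>y. (f ^^ l) y = y \<and>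
          (\<forall>i\<le>l. d ((f ^^ i) x) ((f ^^ i) y) \<le> \<beta>\<^sub>0 * \<delta> * \<Lambda> powi (- (int l - int i)) \<and>
                  \<beta>\<^sub>0 * \<delta> * \<Lambda> powi (- (int l - int i)) \<le> \<eta> / 2))))"
proof -
  have sphere: "(UNIV :: 'a set) homeomorphic sphere (0 :: real ^ 3) 1" and atlas: "oriented_atlas A"
    using assms(1) unfolding oriented_sphere_def by blast+
  have branched: "branched_covering A f" using assms(2) unfolding Thurston_map_def by blast
  have metric: "Metric_space UNIV d" and "\<Lambda> > 1"
    using assms(4) by (simp_all add: visual_metric_def)
  obtain D K where D: "Jordan_curve D" and "K \<ge> 1" and estimates: "\<forall>n.
      (\<forall>\<sigma>\<in>cells A f D n. \<forall>\<tau>\<in>cells A f D n. \<sigma> \<inter> \<tau> = {} \<longrightarrow>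
        ereal (inverse K * \<Lambda> powi (- int n)) \<le> set_dist d \<sigma> \<tau>) \<and>
      (\<forall>\<tau>\<in>edges A f D n \<union> tiles f D n.
        ereal (inverse K * \<Lambda> powi (- int n)) \<le> diam d \<tau> \<and>
        diam d \<tau> \<le> ereal (K * \<Lambda> powi (- int n)))"
    using assms(4) unfolding visual_metric_def by blast
  define q where "q = inverse \<Lambda>"
  have q: "0 < q" "q < 1" using \<open>\<Lambda> > 1\<close> by (auto simp: q_def inverse_less_1_iff)
  have powi: "\<Lambda> powi (- int n) = q ^ n" for n
    by (simp add: q_def power_int_minus power_inverse)
  have "compact D"
    using homeomorphic_compactness[OF D[unfolded Jordan_curve_def]] by simp
  \<comment> \<open>The tiles are those of the curve for which the metric estimates are given.\<close>
  interpret visual_sphere_map f D d K q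
  proof (intro visual_sphere_map.intro open_sphere_map.intro visual_sphere_map_axioms.intro)
    show "compact (UNIV :: 'a set)" using sphere_compact sphere .
    show "closed L" if "compact L" for L :: "'a set" using sphere_compact_imp_closed[OF sphere that] .
    show "open L" if "open W" "L \<in> components W" for W L :: "'a set"
      using open_component_of_atlas[OF atlas that] .
    show "continuous_on UNIV f" using branched unfolding branched_covering_def by blast
    show "open (f ` W)" if "open W" for W using branched_covering_open[OF branched that] .
    show "finite (f -` {p})" for p
      using branched_covering_finite_fibre[OF branched] sphere_compact[OF sphere] by blast
    show "finite (components (- D))" "closure (- D) = UNIV" using Jordan_curve_on_sphere[OF sphere D] .
    show "closed D" using sphere_compact_imp_closed[OF sphere \<open>compact D\<close>] .
    show "Metric_space UNIV d" "1 \<le> K" "0 < q" "q < 1" by fact+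
  next
    fix n X x y assume X: "X \<in> tiles f D n" "x \<in> X" "y \<in> X"
    have "ereal (d x y) \<le> diam d X"
      unfolding diam_def using X by (meson SUP_upper2 order_refl)
    also have "\<dots> \<le> ereal (K * q ^ n)" using estimates X(1) unfolding powi by blast
    finally show "d x y \<le> K * q ^ n" by simp
  next
    fix n X Y x y assume X: "X \<in> tiles f D n" "Y \<in> tiles f D n" "X \<inter> Y = {}" "x \<in> X" "y \<in> Y"
    have "ereal (inverse K * q ^ n) \<le> set_dist d X Y"
      using estimates X(1,2,3) unfolding powi cells_def by blast
    also have "\<dots> \<le> ereal (d x y)"
      unfolding set_dist_def using X by (meson INF_lower2 order_refl)
    finally show "q ^ n / K \<le> d x y" by (simp add: field_simps)
  qed
  define \<beta> where "\<beta> = 2 * K\<^sup>2 / (q * (1 - q))"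
  have "q * (1 - q) < 1" using q mult_strict_mono[of q 1 "1 - q" 1] by simp
  moreover have "1 \<le> K\<^sup>2" using \<open>K \<ge> 1\<close> by simp
  ultimately have "\<beta> > 1" using q unfolding \<beta>_def by (subst less_divide_eq_1_pos) auto
  show ?thesis
  proof (rule exI[of _ \<beta>], intro conjI allI impI)
    show "1 < \<beta>" by fact
    fix \<eta> :: real assume "0 < \<eta>"
    \<comment> \<open>The first bound makes the return distance smaller than the gap between disjoint tiles of
      level \<open>0\<close>, and the second one gives \<open>\<beta> * \<delta> \<le> \<eta> / 2\<close>.\<close>
    define \<delta>\<^sub>3 where "\<delta>\<^sub>3 = min (1 / (2 * K)) (\<eta> / (2 * \<beta>))"
    show "\<exists>\<delta>\<^sub>3. 0 < \<delta>\<^sub>3 \<and> \<delta>\<^sub>3 < 1 \<and>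
    (\<forall>\<delta>. 0 < \<delta> \<and> \<delta> \<le> \<delta>\<^sub>3 \<longrightarrow>
      (\<forall>x. \<forall>l::nat. l \<ge> 1 \<longrightarrow>
        d x ((f ^^ l) x) \<le> \<delta> \<longrightarrow>
        (\<forall>i\<le>l. point_dist d ((f ^^ i) x) (crit A f) \<ge> ereal \<eta>) \<longrightarrow>
        (\<exists>y. (f ^^ l) y = y \<and>
          (\<forall>i\<le>l. d ((f ^^ i) x) ((f ^^ i) y) \<le> \<beta> * \<delta> * \<Lambda> powi (- (int l - int i)) \<and>
                  \<beta> * \<delta> * \<Lambda> powi (- (int l - int i)) \<le> \<eta> / 2))))"
    proof (rule exI[of _ \<delta>\<^sub>3], intro conjI allI impI)
      show "0 < \<delta>\<^sub>3" using \<open>0 < \<eta>\<close> \<open>\<beta> > 1\<close> \<open>K \<ge> 1\<close> by (simp add: \<delta>\<^sub>3_def)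
      have "1 / (2 * K) < 1" using \<open>K \<ge> 1\<close> by simp
      then show "\<delta>\<^sub>3 < 1" by (simp add: \<delta>\<^sub>3_def)
      fix \<delta> x and l :: nat
      assume \<delta>: "0 < \<delta> \<and> \<delta> \<le> \<delta>\<^sub>3" and "1 \<le> l" "d x ((f ^^ l) x) \<le> \<delta>"
      have "1 / (2 * K) < 1 / K" using \<open>K \<ge> 1\<close> by (simp add: field_simps)
      then have "\<delta> < 1 / K" using \<delta> by (simp add: \<delta>\<^sub>3_def)
      then obtain y where y: "(f ^^ l) y = y"
        "\<And>i. i \<le> l \<Longrightarrow> d ((f ^^ i) x) ((f ^^ i) y) \<le> \<beta> * \<delta> * q ^ (l - i)"
        using closing \<delta> \<open>1 \<le> l\<close> \<open>d x ((f ^^ l) x) \<le> \<delta>\<close> unfolding \<beta>_def by metis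
      have "\<beta> * \<delta> \<le> \<eta> / 2"
        using \<delta> \<open>\<beta> > 1\<close> by (simp add: \<delta>\<^sub>3_def field_simps)
      moreover have "\<beta> * \<delta> * q ^ (l - i) \<le> \<beta> * \<delta> * 1" for i
        using q \<delta> \<open>\<beta> > 1\<close> by (intro mult_left_mono power_le_one) auto
      ultimately have half: "\<beta> * \<delta> * q ^ (l - i) \<le> \<eta> / 2" for i
        by (metis mult.right_neutral order_trans)
      have "\<Lambda> powi (- (int l - int i)) = q ^ (l - i)" if "i \<le> l" for i
        using powi[of "l - i"] that by (simp add: of_nat_diff)
      then show "\<exists>y. (f ^^ l) y = y \<and>
          (\<forall>i\<le>l. d ((f ^^ i) x) ((f ^^ i) y) \<le> \<beta> * \<delta> * \<Lambda> powi (- (int l - int i)) \<and>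
                  \<beta> * \<delta> * \<Lambda> powi (- (int l - int i)) \<le> \<eta> / 2)"
        using y half by (intro exI[of _ y]) simp
    qed
  qed
qed

end
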